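(* Let $\eta_1,\eta_2$ be the true calibration functions of the perturbed score $S(X)$, and define the recalibrated predictor $$T(X)=\big(m'(X),(\sigma^2)'(X)\big)=\big(\eta_1(S(X)),\ \eta_2(S(X))-\eta_1(S(X))^2\big).$$ Then $T$ is perfectly second-order calibrated with respect to its own level sets: (for almost every value $(m',(\sigma^2)')$ of $T(X)$) $$\mathbb{E}[Y\mid T(X)=(m',(\sigma^2)')]=m',\qquad \mathbb{E}[f^*(X)^2\mid T(X)=(m',(\sigma^2)')]=(m')^2+(\sigma^2)'.$$
   Context: Setting: $X$ is a random input, $Y\in\{0,1\}$, $f^*(x)=P(Y=1\mid X=x)$, with no assumptions on $f^*$ or the law of $X$. A higher-order predictor maps $x$ to $(m_{\mathrm{orig}}(x),\sigma^2_{\mathrm{orig}}(x))$ with $m_{\mathrm{orig}}\in[0,1]$, $\sigma^2_{\mathrm{orig}}\in[0,m_{\mathrm{orig}}(1-m_{\mathrm{orig}})]$. The perturbed score $S(X)\in[0,1]\times[0,\tfrac14]$ is obtained by drawing its two coordinates independently (and independently of the label given the original score) from the densities $k_h(\cdot\mid m_{\mathrm{orig}}(X))$ on $[0,1]$ and $k_h(\cdot\mid\sigma^2_{\mathrm{orig}}(X))$ on $[0,\tfrac14]$, where for $s\in[a,b]$ and bandwidth $h>0$, $k_h(t\mid s)=\mathrm{sech}((t-s)/h)\mathbf 1_{[a,b]}(t)\big/\int_a^b\mathrm{sech}((u-s)/h)\,du$. The calibration functions are $\eta_1(s)=\mathbb E[Y\mid S(X)=s]$ and $\eta_2(s)=\mathbb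 E[f^*(X)^2\mid S(X)=s]$. $S(X)$ and $T(X)$ are random variables that depend on $X$ and on the perturbation noise. *)

theory Defs
  imports "HOL-Probability.Probability"
begin

text \<open>
  \<open>cond_exp_version M N S Z g\<close>: the function \<open>g\<close> on the value space \<open>N\<close> of \<open>S\<close> is a version of
  \<open>s \<mapsto> E[Z | S = s]\<close>. Such a \<open>g\<close> is unique up to null sets of the law of \<open>S\<close>, so the predicate
  says exactly that \<open>E[Z | S = s] = g s\<close> for almost every value \<open>s\<close> of \<open>S\<close>.
  It is meaningful only for measurable \<open>S\<close> and integrable \<open>Z\<close>.
\<close>

definition cond_exp_version ::
    "'w measure \<Rightarrow> 's measure \<Rightarrow> ('w \<Rightarrow> 's) \<Rightarrow> ('w \<Rightarrow> real) \<Rightarrow> ('s \<Rightarrow> real) \<Rightarrow> bool" where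
  "cond_exp_version M N S Z g \<longleftrightarrow>
     g \<in> borel_measurable N \<and>
     (AE w in M. real_cond_exp M (vimage_algebra (space M) S N) Z w = g (S w))"

definition cond_indep ::
    "'w measure \<Rightarrow> 's measure \<Rightarrow> ('w \<Rightarrow> 's) \<Rightarrow> 't measure \<Rightarrow> ('w \<Rightarrow> 't) \<Rightarrow>
     'o measure \<Rightarrow> ('w \<Rightarrow> 'o) \<Rightarrow> bool" where
  "cond_indep M NS S NT T NO R \<longleftrightarrow>
     (\<forall>A\<in>sets NS. \<forall>B\<in>sets NT. AE w in M.
        real_cond_exp M (vimage_algebra (space M) R NO)
            (\<lambda>w. indicat_real A (S w) * indicat_real B (T w)) w
        = real_cond_exp M (vimage_algebra (space M) R NO) (\<lambda>w. indicat_real A (S w)) w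
        * real_cond_exp M (vimage_algebra (space M) R NO) (\<lambda>w. indicat_real B (T w)) w)"

definition sech :: "real \<Rightarrow> real" where
  "sech x = 1 / cosh x"

definition sech_kernel :: "real \<Rightarrow> real \<Rightarrow> real \<Rightarrow> real \<Rightarrow> real \<Rightarrow> real" where
  "sech_kernel a b h s t =
     sech ((t - s) / h) * indicator {a..b} t / (LINT u:{a..b}|lborel. sech ((u - s) / h))"

definition perturbation_law :: "real \<Rightarrow> real \<Rightarrow> real \<Rightarrow> (real \<times> real) measure" where
  "perturbation_law h m v =
     density lborel (\<lambda>t. ennreal (sech_kernel 0 1 h m t)) \<Otimes>\<^sub>M
     density lborel (\<lambda>t. ennreal (sech_kernel 0 (1/4) h v t))"

text \<open>
  Conditionally on \<open>X\<close>, the perturbed score \<open>S\<close> is distributed according to the product of the two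
  kernels centred at the original scores \<open>m (X)\<close> and \<open>v (X)\<close> (\<open>v\<close> being the variance score),
  and it is independent of the label \<open>Y\<close> given the pair of original scores.
\<close>

definition perturbed_score ::
    "'w measure \<Rightarrow> 'x measure \<Rightarrow> ('w \<Rightarrow> 'x) \<Rightarrow> ('w \<Rightarrow> real) \<Rightarrow> ('x \<Rightarrow> real) \<Rightarrow> ('x \<Rightarrow> real) \<Rightarrow> real \<Rightarrow>
     ('w \<Rightarrow> real \<times> real) \<Rightarrow> bool" where
  "perturbed_score M MX X Y m v h S \<longleftrightarrow>
     S \<in> borel_measurable M \<and>
     (\<forall>w\<in>space M. S w \<in> {0..1} \<times> {0..1/4}) \<and>
     (\<forall>A\<in>sets borel. cond_exp_version M MX X (\<lambda>w. indicator A (S w))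
                        (\<lambda>x. measure (perturbation_law h (m x) (v x)) A)) \<and>
     cond_indep M borel S borel Y borel (\<lambda>w. (m (X w), v (X w)))"

text \<open>
  Second-order calibration of a predictor \<open>T = (m', v')\<close> on its own level sets, where the random
  variable \<open>p\<close> is the true conditional label probability at the input.
\<close>

definition second_order_calibrated ::
    "'w measure \<Rightarrow> ('w \<Rightarrow> real) \<Rightarrow> ('w \<Rightarrow> real) \<Rightarrow> ('w \<Rightarrow> real \<times> real) \<Rightarrow> bool" where
  "second_order_calibrated M Y p T \<longleftrightarrow>
     T \<in> borel_measurable M \<and>
     cond_exp_version M borel T Y (\<lambda>(m', v'). m') \<and>
     cond_exp_version M borel T (\<lambda>w. (p w)\<^sup>2) (\<lambda>(m', v'). m'\<^sup>2 + v')"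

end

theory Submission
  imports Defs
begin

lemma subalgebra_vimage_algebra:
  assumes "f \<in> measurable M N"
  shows "subalgebra M (vimage_algebra (space M) f N)"
  unfolding subalgebra_def
proof
  show "sets (vimage_algebra (space M) f N) \<subseteq> sets M"
    using assms by (auto simp: sets_vimage_algebra2 measurable_space)
qed simp

text \<open>Tower property for \<open>\<sigma>(\<phi> \<circ> S) \<subseteq> \<sigma>(S)\<close>: as \<open>g \<circ> S\<close> is already \<open>\<sigma>(\<phi> \<circ> S)\<close>-measurable, conditioning
  it once more does nothing.\<close>

lemma (in finite_measure) cond_exp_version_comp:
  assumes S: "S \<in> measurable M N" and \<phi>: "\<phi> \<in> measurable N K"
    and Z: "integrable M Z" and g: "cond_exp_version M N S Z g"
    and c: "c \<in> borel_measurable K" and gc: "\<And>s. s \<in> space N \<Longrightarrow> g s = c (\<phi> s)"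
  shows "cond_exp_version M K (\<lambda>w. \<phi> (S w)) Z c"
proof -
  \<comment> \<open>\<open>F\<close> carries the information in the full score \<open>S\<close>,
    \<open>G\<close> the coarser information in the level sets of
    \<open>\<phi> \<circ> S\<close>.\<close>
  define F where "F = vimage_algebra (space M) S N"
  define G where "G = vimage_algebra (space M) (\<lambda>w. \<phi> (S w)) K"
  have T: "(\<lambda>w. \<phi> (S w)) \<in> measurable M K"
    using S \<phi> by measurable
  have MF: "subalgebra M F" and MG: "subalgebra M G"
    unfolding F_def G_def by (rule subalgebra_vimage_algebra, fact)+
  have "S \<in> measurable F N"
    unfolding F_def using S by (intro measurable_vimage_algebra1) (auto dest: measurable_space)
  then have "(\<lambda>w. \<phi> (S w)) \<in> measurable F K"
    using \<phi> by measurable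
  \<comment> \<open>The subalgebra lemma is applied with \<open>F\<close> itself as ambient measure;
    this gives \<open>G\<close> because \<open>F\<close> and \<open>M\<close> share their
    space.\<close>
  then have FG: "subalgebra F G"
    using subalgebra_vimage_algebra[of "\<lambda>w. \<phi> (S w)" F K] by (simp add: F_def G_def)
  interpret G: finite_measure_subalgebra M G
    by unfold_locales (fact MG)
  interpret F: finite_measure_subalgebra M F
    by unfold_locales (fact MF)
  have cT: "(\<lambda>w. c (\<phi> (S w))) \<in> borel_measurable G"
    unfolding G_def using T
    by (intro measurable_compose[OF measurable_vimage_algebra1 c]) (auto dest: measurable_space)
  have cTM: "(\<lambda>w. c (\<phi> (S w))) \<in> borel_measurable M"
    using T c by measurable
  have eq: "AE w in M. real_cond_exp M F Z w = c (\<phi> (S w))"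
    using g gc measurable_space[OF S] by (auto simp: cond_exp_version_def F_def)
  \<comment> \<open>No bound on \<open>c\<close> is assumed: integrability is inherited from the
    conditional expectation of \<open>Z\<close>, with which this function agrees a.e.\<close>
  have int: "integrable M (\<lambda>w. c (\<phi> (S w)))"
    using integrable_cong_AE[OF _ cTM eq] F.real_cond_exp_int(1)[OF Z] by auto
  \<comment> \<open>The chain, with all equalities a.e.: E[Z|G] = E[E[Z|F]|G] = E[c(\<phi>(S))|G] =
    c(\<phi>(S)).\<close>
  have "AE w in M. real_cond_exp M G (real_cond_exp M F Z) w = real_cond_exp M G Z w"
    by (rule G.real_cond_exp_nested_subalg[OF MF FG Z])
  moreover have "AE w in M. real_cond_exp M G (real_cond_exp M F Z) w
      = real_cond_exp M G (\<lambda>w. c (\<phi> (S w))) w"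
    using eq cTM by (intro G.real_cond_exp_cong) auto
  moreover have "AE w in M. real_cond_exp M G (\<lambda>w. c (\<phi> (S w))) w = c (\<phi> (S w))"
    by (rule G.real_cond_exp_F_meas[OF int cT])
  ultimately have "AE w in M. real_cond_exp M G Z w = c (\<phi> (S w))"
    by eventually_elim simp
  with c show ?thesis
    by (simp add: cond_exp_version_def G_def)
qed

text \<open>Conditional expectation is monotone and fixes constants, so bounds on \<open>Z\<close>
  carry over to any version. Below this yields the integrability of the squared label
  probability.\<close>

lemma (in finite_measure) cond_exp_version_bounded:
  assumes S: "S \<in> measurable M N" and Z: "integrable M Z"
    and bounds: "AE w in M. a \<le> Z w" "AE w in M. Z w \<le> b"
    and g: "cond_exp_version M N S Z g"
  shows "AE w in M. g (S w) \<in> {a..b}"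
proof -
  interpret F: finite_measure_subalgebra M "vimage_algebra (space M) S N"
    by unfold_locales (rule subalgebra_vimage_algebra[OF S])
  show ?thesis
    using g F.real_cond_exp_ge_c[OF Z bounds(1)] F.real_cond_exp_le_c[OF Z bounds(2)]
    unfolding cond_exp_version_def by auto
qed

theorem proposition3:
  fixes M :: "'w measure" and MX :: "'x measure"
    and X :: "'w \<Rightarrow> 'x" and Y :: "'w \<Rightarrow> real" and fstar :: "'x \<Rightarrow> real"
    and m_orig v_orig :: "'x \<Rightarrow> real" and h :: real
    and S T :: "'w \<Rightarrow> real \<times> real" and \<eta>1 \<eta>2 :: "real \<times> real \<Rightarrow> real"
  assumes "prob_space M"
    and "X \<in> measurable M MX"
    and "Y \<in> borel_measurable M" and "\<forall>w\<in>space M. Y w \<in> {0, 1}"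
    and "cond_exp_version M MX X (\<lambda>w. indicator {1} (Y w)) fstar"
    and "m_orig \<in> borel_measurable MX" and "\<forall>x\<in>space MX. m_orig x \<in> {0..1}"
    and "v_orig \<in> borel_measurable MX"
    and "\<forall>x\<in>space MX. v_orig x \<in> {0..m_orig x * (1 - m_orig x)}"
    and "h > 0"
    and "perturbed_score M MX X Y m_orig v_orig h S"
    and "cond_exp_version M borel S Y \<eta>1"
    and "cond_exp_version M borel S (\<lambda>w. (fstar (X w))\<^sup>2) \<eta>2"
    and "T = (\<lambda>w. (\<eta>1 (S w), \<eta>2 (S w) - (\<eta>1 (S w))\<^sup>2))"
  shows "second_order_calibrated M Y (\<lambda>w. fstar (X w)) T"
proof -
  interpret prob_space M by fact
  note [measurable] = assms(2,3)
  have [measurable]: "fstar \<in> borel_measurable MX"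
      "\<eta>1 \<in> borel_measurable borel" "\<eta>2 \<in> borel_measurable borel"
    using assms(5,12,13) by (simp_all add: cond_exp_version_def)
  have S [measurable]: "S \<in> borel_measurable M"
    using assms(11) by (simp add: perturbed_score_def)
  \<comment> \<open>Recalibration is a deterministic map of the score, so \<open>T\<close> factors
    through \<open>S\<close>.\<close>
  define \<phi> where "\<phi> = (\<lambda>s. (\<eta>1 s, \<eta>2 s - (\<eta>1 s)\<^sup>2))"
  have \<phi> [measurable]: "\<phi> \<in> borel_measurable borel"
    unfolding \<phi>_def by measurable
  have T: "T = (\<lambda>w. \<phi> (S w))"
    by (simp add: assms(14) \<phi>_def)
  have Y_int: "integrable M Y"
    using assms(4) by (intro integrable_const_bound[where B = 1] AE_I2) auto
  have "integrable M (\<lambda>w. indicator {1} (Y w) :: real)"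
    by (intro integrable_const_bound[where B = 1]) (auto simp: indicator_def)
  \<comment> \<open>As a version, \<open>fstar\<close> is determined only up to null sets of the law
    of \<open>X\<close>, so its range is controlled only a.e.; this is enough to make its square
    integrable.\<close>
  then have "AE w in M. fstar (X w) \<in> {0..1}"
    using assms(2,5) by (intro cond_exp_version_bounded) (auto simp: indicator_def)
  then have "integrable M (\<lambda>w. (fstar (X w))\<^sup>2)"
    by (intro integrable_const_bound[where B = 1]) (auto simp: power_le_one)
  moreover have "(\<lambda>(m, v). m\<^sup>2 + v) \<in> borel_measurable (borel :: (real \<times> real) measure)"
    "(\<lambda>(m, v). m) \<in> borel_measurable (borel :: (real \<times> real) measure)"
    unfolding borel_prod[symmetric] by measurable
  \<comment> \<open>Both \<open>\<eta>1\<close> and \<open>\<eta>2\<close> can be read off from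
    \<open>\<phi>\<close>: the first is its first coordinate, and m^2 + v restores the second, since
    \<eta>1^2 + (\<eta>2 - \<eta>1^2) = \<eta>2.\<close>
  ultimately have "cond_exp_version M borel T Y (\<lambda>(m, v). m)"
    "cond_exp_version M borel T (\<lambda>w. (fstar (X w))\<^sup>2) (\<lambda>(m, v). m\<^sup>2 + v)"
    unfolding T using Y_int assms(12,13)
    by - (rule cond_exp_version_comp[OF S \<phi>]; simp add: \<phi>_def)+
  then show ?thesis
    unfolding second_order_calibrated_def by (simp add: T)
qed

end
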